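(* Consider the one-dimensional CU scheme described in the context. If $\mathbf u^\pm_{j+\frac12}\in\mathcal G$, $\mathbf u^{*,\pm}_{j+\frac12}\in\mathcal G$ and $\mathbf u^*_j\in\mathcal G$ for all $j$, then, under the CFL condition $$\lambda^n\max_j\big\{\sigma^+_{j+\frac12}-\sigma^-_{j+\frac12}\big\}\le\tfrac12,$$ one has $\overline{\mathbf u}_j^{\,n+1}\in\mathcal G$ for all $j$, that is, the scheme is bound-preserving.
   Context: Consider a 1-D hyperbolic system of conservation laws $\mathbf u_t+\mathbf f(\mathbf u)_x=\mathbf 0$, $\mathbf u\in\mathbb R^m$, with a convex invariant region $$\mathcal G=\{\mathbf u\in\mathbb R^m:\varphi_i(\mathbf u)>0,\ i\in\mathbb I,\ \text{and}\ \varphi_i(\mathbf u)\ge0,\ i\in\hat{\mathbb I}\}$$ ($\varphi_i$ continuous, $\mathcal G$ convex, $\mathbf f$ defined on $\mathcal G$). With $\Delta x,\Delta t^n>0$, $\lambda^n:=\Delta t^n/\Delta x$ and cell averages $\overline{\mathbf u}_j^{\,n}$, $j\in\mathbb Z$, the CU scheme is $$\overline{\mathbf u}^{\,n+1}_j=\overline{\mathbf u}^{\,n}_j-\lambda^n\big(\hat{\mathbf f}_{j+\frac12}-\hat{\mathbf f}_{j-\frac12}\big),$$ $$\hat{\mathbf f}_{j+\frac12}=\frac{\sigma^+_{j+\frac12}\mathbf f(\mathbf u^-_{j+\frac12})-\sigma^-_{j+\frac12}\mathbf f(\mathbf u^+_{j+\frac12})}{\sigma^+_{j+\frac12}-\sigma^-_{j+\frac12}}+\frac{\sigma^+_{j+\frac12}\sigma^-_{j+\frac12}}{\sigma^+_{j+\frac12}-\sigma^-_{j+\frac12}}\big(\mathbf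 u^+_{j+\frac12}-\mathbf u^-_{j+\frac12}-\mathbf d_{j+\frac12}\big).$$ Here $\mathbf u^-_{j+\frac12}=\overline{\mathbf u}_j^{\,n}+\frac{\Delta x}{2}(\mathbf u_x)_j^n$ and $\mathbf u^+_{j+\frac12}=\overline{\mathbf u}_{j+1}^{\,n}-\frac{\Delta x}{2}(\mathbf u_x)_{j+1}^n$ for some slopes $(\mathbf u_x)^n_j\in\mathbb R^m$; $\sigma^\pm_{j+\frac12}$ are one-sided local speeds with $\sigma^-_{j+\frac12}\le0\le\sigma^+_{j+\frac12}$, $\sigma^+_{j+\frac12}>\sigma^-_{j+\frac12}$ and $\sigma^+_{j+\frac12}>\sigma^-_{j-\frac12}$ for all $j$; and $\mathbf d_{j+\frac12}\in\mathbb R^m$ is the anti-diffusion term. Define $$R_f(\sigma^+,\sigma^-,\mathbf u^+,\mathbf u^-):=\frac{\sigma^+\mathbf u^+-\sigma^-\mathbf u^--\mathbf f(\mathbf u^+)+\mathbf f(\mathbf u^-)}{\sigma^+-\sigma^-},\qquad \mathbf u^*_{j+\frac12}=R_f\big(\sigma^+_{j+\frac12},\sigma^-_{j+\frac12},\mathbf u^+_{j+\frac12},\mathbf u^-_{j+\frac12}\big),$$ $$\mathbf u^{*,\pm}_{j+\frac12}:=\mathbf u^*_{j+\frac12}-\frac{\sigma^\pm_{j+\frac12}}{\sigma^+_{j+\frac12}-\sigma^-_{j+\frac12}}\mathbf d_{j+\frac12},\qquad \mathbf u^*_j:=R_f\big(\sigma^+_{j+\frac12},\sigma^-_{j-\frac12},\mathbf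 u^-_{j+\frac12},\mathbf u^+_{j-\frac12}\big).$$ *)

theory Defs
  imports "HOL-Analysis.Analysis"
begin

text \<open>
  Conventions: a quantity located at the interface \<open>j + 1/2\<close> is indexed by the integer \<open>j\<close>,
  hence one at \<open>j - 1/2\<close> by \<open>j - 1\<close>. The maximum over all cells in a CFL condition is
  taken as a supremum in the extended reals, so that it always makes sense.
\<close>

definition admissible_region ::
  "('i \<Rightarrow> real ^ 'm \<Rightarrow> real) \<Rightarrow> 'i set \<Rightarrow> 'i set \<Rightarrow> (real ^ 'm) set" where
  "admissible_region \<phi> I J = {u. (\<forall>i\<in>I. \<phi> i u > 0) \<and> (\<forall>i\<in>J. \<phi> i u \<ge> 0)}"

definition real_diagonalizable :: "real ^ 'm ^ 'm \<Rightarrow> bool" where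
  "real_diagonalizable A \<longleftrightarrow>
     (\<exists>B. independent B \<and> span B = UNIV \<and> (\<forall>v\<in>B. \<exists>c. A *v v = c *\<^sub>R v))"

text \<open>
  Hyperbolicity of \<open>u\<^sub>t + f(u)\<^sub>x = 0\<close> is imposed at interior states only: at boundary
  states belonging to the region (for instance vacuum) the derivative of a flux that is given only
  on the region is not determined in general, and hyperbolicity may degenerate.
  Fluxes are total functions in HOL; their values outside the region play no role.
\<close>
definition hyperbolic_on :: "(real ^ 'm) set \<Rightarrow> (real ^ 'm \<Rightarrow> real ^ 'm) \<Rightarrow> bool" where
  "hyperbolic_on G f \<longleftrightarrow>
     (\<forall>u\<in>interior G. f differentiable (at u) \<and> real_diagonalizable (jacobian f (at u)))"

definition R_f ::
  "(real ^ 'm \<Rightarrow> real ^ 'm) \<Rightarrow> real \<Rightarrow> real \<Rightarrow> real ^ 'm \<Rightarrow> real ^ 'm \<Rightarrow> real ^ 'm" where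
  "R_f f \<sigma>p \<sigma>m up um =
     (1 / (\<sigma>p - \<sigma>m)) *\<^sub>R (\<sigma>p *\<^sub>R up - \<sigma>m *\<^sub>R um - f up + f um)"

definition cu_flux ::
  "(real ^ 'm \<Rightarrow> real ^ 'm) \<Rightarrow> real \<Rightarrow> real \<Rightarrow> real ^ 'm \<Rightarrow> real ^ 'm \<Rightarrow> real ^ 'm \<Rightarrow> real ^ 'm"
  where
  "cu_flux f \<sigma>p \<sigma>m up um d =
     (1 / (\<sigma>p - \<sigma>m)) *\<^sub>R (\<sigma>p *\<^sub>R f um - \<sigma>m *\<^sub>R f up)
     + (\<sigma>p * \<sigma>m / (\<sigma>p - \<sigma>m)) *\<^sub>R (up - um - d)"

end

theory Submission
  imports Defs
begin

text \<open>
  The numerical flux at an interface has two equivalent forms, one in terms of the left state and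
  \<open>ustarp\<close>, one in terms of the right state and \<open>ustarm\<close>. Using the former at
  \<open>j + 1/2\<close> and the latter at \<open>j - 1/2\<close>, the remaining difference of physical fluxes
  is absorbed by \<open>ustarc\<close>. As \<open>ubar j\<close> is the mean of the two reconstructed states in
  the cell, this writes \<open>unew j\<close> as a convex combination of five points of \<open>G\<close>: the
  CFL condition makes the weights of the two reconstructed states nonnegative.
\<close>

lemma R_f_scale:
  assumes "\<sigma>p \<noteq> \<sigma>m"
  shows "(\<sigma>p - \<sigma>m) *\<^sub>R R_f f \<sigma>p \<sigma>m up um = \<sigma>p *\<^sub>R up - \<sigma>m *\<^sub>R um - f up + f um"
  using assms by (simp add: R_f_def)

text \<open>Rankine-Hugoniot relation across the wave of speed \<open>\<sigma>m\<close>, with the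
  anti-diffusion shifting the intermediate state.\<close>

lemma cu_flux_left:
  assumes "\<sigma>p \<noteq> \<sigma>m"
  shows "cu_flux f \<sigma>p \<sigma>m up um d =
    f um - \<sigma>m *\<^sub>R um + \<sigma>m *\<^sub>R (R_f f \<sigma>p \<sigma>m up um - (\<sigma>p / (\<sigma>p - \<sigma>m)) *\<^sub>R d)"
  using assms
  by (simp add: vec_eq_iff R_f_def cu_flux_def divide_simps) (simp add: algebra_simps)

text \<open>The mirror relation, across the wave of speed \<open>\<sigma>p\<close>.\<close>

lemma cu_flux_right:
  assumes "\<sigma>p \<noteq> \<sigma>m"
  shows "cu_flux f \<sigma>p \<sigma>m up um d =
    f up - \<sigma>p *\<^sub>R up + \<sigma>p *\<^sub>R (R_f f \<sigma>p \<sigma>m up um - (\<sigma>m / (\<sigma>p - \<sigma>m)) *\<^sub>R d)"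
  using assms
  by (simp add: vec_eq_iff R_f_def cu_flux_def divide_simps) (simp add: algebra_simps)

lemma convexD5:
  assumes "convex S" "x1 \<in> S" "x2 \<in> S" "x3 \<in> S" "x4 \<in> S" "x5 \<in> S"
    and "0 \<le> a1" "0 \<le> a2" "0 \<le> a3" "0 \<le> a4" "0 \<le> a5" "a1 + a2 + a3 + a4 + a5 = 1"
  shows "a1 *\<^sub>R x1 + a2 *\<^sub>R x2 + a3 *\<^sub>R x3 + a4 *\<^sub>R x4 + a5 *\<^sub>R x5 \<in> S"
proof -
  \<comment> \<open>List indexing presents the five points as a finite family, the form
    \<open>convex_sum\<close> expects.\<close>
  have "(\<Sum>i<5. ([a1, a2, a3, a4, a5] ! i) *\<^sub>R ([x1, x2, x3, x4, x5] ! i)) \<in> S"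
    by (rule convex_sum)
      (use assms in \<open>auto simp: eval_nat_numeral lessThan_Suc less_Suc_eq add_ac\<close>)
  then show ?thesis
    by (simp add: eval_nat_numeral lessThan_Suc add_ac)
qed

theorem corollary2p1:
  fixes \<phi> :: "'i \<Rightarrow> real ^ 'm \<Rightarrow> real" and I J :: "'i set"
    and G :: "(real ^ 'm) set"
    and f :: "real ^ 'm \<Rightarrow> real ^ 'm"
    and dx dt lam :: real
    and ubar ux unew :: "int \<Rightarrow> real ^ 'm"
    and um up d ustar ustarp ustarm ustarc :: "int \<Rightarrow> real ^ 'm"
    and \<sigma>p \<sigma>m :: "int \<Rightarrow> real"
  assumes G_def: "G = admissible_region \<phi> I J"
    and \<phi>_cont: "\<And>i. i \<in> I \<union> J \<Longrightarrow> continuous_on UNIV (\<phi> i)"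
    and G_convex: "convex G"
    and f_hyp: "hyperbolic_on G f"
    and dx_pos: "dx > 0" and dt_pos: "dt > 0"
    and lam_def: "lam = dt / dx"
    and um_def: "\<And>j. um j = ubar j + (dx / 2) *\<^sub>R ux j"
    and up_def: "\<And>j. up j = ubar (j + 1) - (dx / 2) *\<^sub>R ux (j + 1)"
    and \<sigma>_sign: "\<And>j. \<sigma>m j \<le> 0" "\<And>j. 0 \<le> \<sigma>p j"
    and \<sigma>_less: "\<And>j. \<sigma>p j > \<sigma>m j"
    and \<sigma>_less_prev: "\<And>j. \<sigma>p j > \<sigma>m (j - 1)"
    and scheme: "\<And>j. unew j = ubar j - lam *\<^sub>R
          (cu_flux f (\<sigma>p j) (\<sigma>m j) (up j) (um j) (d j)
           - cu_flux f (\<sigma>p (j - 1)) (\<sigma>m (j - 1)) (up (j - 1)) (um (j - 1)) (d (j - 1)))"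
    and ustar_def: "\<And>j. ustar j = R_f f (\<sigma>p j) (\<sigma>m j) (up j) (um j)"
    and ustarp_def: "\<And>j. ustarp j = ustar j - (\<sigma>p j / (\<sigma>p j - \<sigma>m j)) *\<^sub>R d j"
    and ustarm_def: "\<And>j. ustarm j = ustar j - (\<sigma>m j / (\<sigma>p j - \<sigma>m j)) *\<^sub>R d j"
    and ustarc_def: "\<And>j. ustarc j = R_f f (\<sigma>p j) (\<sigma>m (j - 1)) (um j) (up (j - 1))"
    and u_in_G: "\<And>j. up j \<in> G" "\<And>j. um j \<in> G"
    and ustarpm_in_G: "\<And>j. ustarp j \<in> G" "\<And>j. ustarm j \<in> G"
    and ustarc_in_G: "\<And>j. ustarc j \<in> G"
    and CFL: "ereal lam * (SUP j. ereal (\<sigma>p j - \<sigma>m j)) \<le> ereal (1 / 2)"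
  shows "\<forall>j. unew j \<in> G"
proof
  fix j :: int
  define k where "k = j - 1"
  have lam_pos: "0 < lam"
    using dx_pos dt_pos by (simp add: lam_def)
  have cfl: "lam * (\<sigma>p i - \<sigma>m i) \<le> 1 / 2" for i
  proof -
    \<comment> \<open>In the extended reals the supremum bounds each term with no boundedness check
      beforehand.\<close>
    have "ereal lam * ereal (\<sigma>p i - \<sigma>m i) \<le> ereal lam * (SUP j. ereal (\<sigma>p j - \<sigma>m j))"
      by (intro ereal_mult_left_mono SUP_upper) (use lam_pos in auto)
    also note CFL
    finally show ?thesis by simp
  qed
  have ubar: "ubar j = (1 / 2) *\<^sub>R um j + (1 / 2) *\<^sub>R up k"
    by (simp add: um_def up_def k_def scaleR_diff_right scaleR_add_right flip: scaleR_add_left)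
  \<comment> \<open>Here \<open>right\<close> and \<open>left\<close> name the interfaces of cell
    \<open>j\<close>; its state lies to the left of the interface \<open>j\<close> and to the right
    of the interface \<open>k\<close>.\<close>
  have right: "cu_flux f (\<sigma>p j) (\<sigma>m j) (up j) (um j) (d j) =
      f (um j) - \<sigma>m j *\<^sub>R um j + \<sigma>m j *\<^sub>R ustarp j"
    using \<sigma>_less[of j] by (simp add: cu_flux_left ustarp_def ustar_def)
  have left: "cu_flux f (\<sigma>p k) (\<sigma>m k) (up k) (um k) (d k) =
      f (up k) - \<sigma>p k *\<^sub>R up k + \<sigma>p k *\<^sub>R ustarm k"
    using \<sigma>_less[of k] by (simp add: cu_flux_right ustarm_def ustar_def)
  have "(\<sigma>p j - \<sigma>m k) *\<^sub>R ustarc j = \<sigma>p j *\<^sub>R um j - \<sigma>m k *\<^sub>R up k - f (um j) + f (up k)"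
    unfolding ustarc_def k_def using \<sigma>_less_prev[of j] by (intro R_f_scale) simp
  \<comment> \<open>Substituting this for \<open>f (um j)\<close> makes the two copies of
    \<open>f (up k)\<close> cancel, so no physical flux survives.\<close>
  then have fdiff:
    "f (um j) = \<sigma>p j *\<^sub>R um j - \<sigma>m k *\<^sub>R up k + f (up k) - (\<sigma>p j - \<sigma>m k) *\<^sub>R ustarc j"
    by (simp add: algebra_simps)
  have "unew j = ubar j - lam *\<^sub>R ((f (um j) - \<sigma>m j *\<^sub>R um j + \<sigma>m j *\<^sub>R ustarp j)
      - (f (up k) - \<sigma>p k *\<^sub>R up k + \<sigma>p k *\<^sub>R ustarm k))"
    using scheme[of j] right left by (simp add: k_def)
  also have "\<dots> = (1 / 2 - lam * (\<sigma>p j - \<sigma>m j)) *\<^sub>R um j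
      + (1 / 2 - lam * (\<sigma>p k - \<sigma>m k)) *\<^sub>R up k
      + (lam * (\<sigma>p j - \<sigma>m k)) *\<^sub>R ustarc j
      + (lam * (- \<sigma>m j)) *\<^sub>R ustarp j + (lam * \<sigma>p k) *\<^sub>R ustarm k"
    unfolding ubar fdiff by (simp add: algebra_simps)
  \<comment> \<open>The weight of \<open>ustarc j\<close> is nonnegative by
    \<open>\<sigma>_less_prev\<close>, the last two by \<open>\<sigma>_sign\<close>; all speeds
    cancel in the sum of the weights, leaving 1/2 + 1/2.\<close>
  also have "\<dots> \<in> G"
    by (rule convexD5[OF G_convex u_in_G(2) u_in_G(1) ustarc_in_G ustarpm_in_G])
      (use cfl[of j] cfl[of k] lam_pos \<sigma>_sign[of j] \<sigma>_sign[of k] \<sigma>_less_prev[of j]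
        in \<open>auto simp: k_def mult_nonneg_nonpos algebra_simps\<close>)
  finally show "unew j \<in> G" .
qed

end
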